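(* Let $n$ be a non-negative integer. Let $E_n$ be the set of all clones $C$ on $\{0,1\}^n$ such that (a) for every $m\in\mathbb N$ and all $m$-ary operations $f_1,\dots,f_n$ on $\{0,1\}$, the component-wise operation $\big((x_{11},\dots,x_{n1}),\dots,(x_{1m},\dots,x_{nm})\big)\mapsto \big(f_1(x_{11},\dots,x_{1m}),\dots,f_n(x_{n1},\dots,x_{nm})\big)$ on $\{0,1\}^n$ belongs to $C$; and (b) $\{\{0\}^{i-1}\times\{0,1\}\times\{0\}^{n-i}\mid i\in\{1,\dots,n\}\}$ is an irredundant non-refinable cover of the algebra $(\{0,1\}^n,C)$. Let $O_n$ be the set of all partial order relations on $\{1,\dots,n\}$. For $C\in E_n$ define a relation $\leq_C$ on $\{1,\dots,n\}$ by: $i_1\leq_C i_2$ if and only if for all $r_1,\dots,r_n\subset\{0,1\}^2$ with $\prod_{i=1}^n r_i\in\mathrm{Inv}_2(C)$, $r_{i_1}=\{0,1\}^2$ implies $r_{i_2}=\{0,1\}^2$. Then $C\mapsto\ \leq_C$ is a bijection from $E_n$ onto $O_n$.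
   Context: $\mathbb N$ includes $0$, and $\subset$ allows equality. For $n\in\mathbb N$, an $n$-ary operation on a set $X$ is a map $X^n\to X$ ($n=0$ allowed). A clone on $X$ is a set of operations on $X$ containing all projections and closed under composition: if $f\in C$ is $n$-ary and $g_1,\dots,g_n\in C$ are $m$-ary, then $f(g_1,\dots,g_n)\in C$ ($n,m\in\mathbb N$). An $m$-ary relation $r\subset X^m$ is invariant to a set $F$ of operations if for every $f\in F$ (of arity $n$, say), applying $f$ coordinatewise to any $n$ tuples of $r$ gives a tuple of $r$; $\mathrm{Inv}(F)$ is the set of all invariant relations and $\mathrm{Inv}_m(F)$ the set of $m$-ary ones. For $r_i\subset A_i^m$ ($1\le i\le n$), $\prod_{i=1}^n r_i$ is the $m$-ary relation on $\prod_{i=1}^n A_i$ consisting of all $\big((x_{11},\dots,x_{n1}),\dots,(x_{1m},\dots,x_{nm})\big)$ with $(x_{i1},\dots,x_{im})\in r_i$ for all $i$. An algebra is a pair $A=(A,\mathrm{Clo}(A))$ of a set and a clone on it; $\mathrm{Inv}(A):=\mathrm{Inv}(\mathrm{Clo}(A))$. A neighbourhood of $A$ is a set $U=e(A)$ for some unary $e\in\mathrm{Clo}(A)$ with $e\circ e=e$. A set $\mathcal U$ of neighbourhoods covers $A$ (is a cover of $A$) if for all $r,s\in\mathrm{Inv}(A)$ (of the same arity $m$), $r\cap U^m=s\cap U^m$ for all $U\in\mathcal U$ implies $r=s$. A cover $\mathcal U$ is irredundant if no proper subset of $\mathcal U$ covers $A$. A cover $\mathcal U'$ is a refinement of a cover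 $\mathcal U$ if every $U'\in\mathcal U'$ is contained in some $U\in\mathcal U$; it is a proper refinement if moreover $\mathcal U$ is not a refinement of $\mathcal U'$. A cover is non-refinable if it has no proper refinement. *)

theory Defs
  imports "HOL-Library.FuncSet"
begin

section \<open>Tuples, operations and clones\<close>

text \<open>The tuple \<open>(x\<^sub>1, \<dots>, x\<^sub>n)\<close> is the function \<open>\<lambda>i\<in>{1..n}. x\<^sub>i\<close>, which is
  \<open>undefined\<close> outside \<open>{1..n}\<close>; so there is exactly one \<open>0\<close>-tuple.\<close>

definition tuples :: "nat \<Rightarrow> 'a set \<Rightarrow> (nat \<Rightarrow> 'a) set" where
  "tuples n X = {1..n} \<rightarrow>\<^sub>E X"

definition operations :: "nat \<Rightarrow> 'a set \<Rightarrow> ((nat \<Rightarrow> 'a) \<Rightarrow> 'a) set" where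
  "operations n X = tuples n X \<rightarrow>\<^sub>E X"

text \<open>Operations carry their arity: \<open>(n, f)\<close> with \<open>f \<in> operations n X\<close>.\<close>

type_synonym 'a oper = "nat \<times> ((nat \<Rightarrow> 'a) \<Rightarrow> 'a)"

definition projection :: "'a set \<Rightarrow> nat \<Rightarrow> nat \<Rightarrow> (nat \<Rightarrow> 'a) \<Rightarrow> 'a" where
  "projection X n i = (\<lambda>x\<in>tuples n X. x i)"

definition compose_op ::
  "'a set \<Rightarrow> nat \<Rightarrow> nat \<Rightarrow> ((nat \<Rightarrow> 'a) \<Rightarrow> 'a) \<Rightarrow> (nat \<Rightarrow> (nat \<Rightarrow> 'a) \<Rightarrow> 'a) \<Rightarrow> (nat \<Rightarrow> 'a) \<Rightarrow> 'a" where
  "compose_op X n m f g = (\<lambda>x\<in>tuples m X. f (\<lambda>i\<in>{1..n}. g i x))"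

definition clone :: "'a set \<Rightarrow> 'a oper set \<Rightarrow> bool" where
  "clone X C \<longleftrightarrow>
     (\<forall>(n, f)\<in>C. f \<in> operations n X) \<and>
     (\<forall>n. \<forall>i\<in>{1..n}. (n, projection X n i) \<in> C) \<and>
     (\<forall>n m f g. (n, f) \<in> C \<and> (\<forall>i\<in>{1..n}. (m, g i) \<in> C) \<longrightarrow> (m, compose_op X n m f g) \<in> C)"

section \<open>Invariant relations\<close>

definition invariant :: "nat \<Rightarrow> (nat \<Rightarrow> 'a) set \<Rightarrow> 'a oper set \<Rightarrow> bool" where
  "invariant m r F \<longleftrightarrow>
     (\<forall>(n, f)\<in>F. \<forall>t. (\<forall>i\<in>{1..n}. t i \<in> r) \<longrightarrow> (\<lambda>j\<in>{1..m}. f (\<lambda>i\<in>{1..n}. t i j)) \<in> r)"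

definition Inv :: "'a set \<Rightarrow> 'a oper set \<Rightarrow> nat \<Rightarrow> (nat \<Rightarrow> 'a) set set" where
  "Inv X F m = {r. r \<subseteq> tuples m X \<and> invariant m r F}"

definition relation_product ::
  "nat \<Rightarrow> nat \<Rightarrow> (nat \<Rightarrow> (nat \<Rightarrow> 'a) set) \<Rightarrow> (nat \<Rightarrow> (nat \<Rightarrow> 'a)) set" where
  "relation_product n m r =
     {\<lambda>j\<in>{1..m}. \<lambda>i\<in>{1..n}. x i j | x. \<forall>i\<in>{1..n}. x i \<in> r i}"

section \<open>Neighbourhoods and covers of an algebra \<open>(A, C)\<close>\<close>

definition unary :: "((nat \<Rightarrow> 'a) \<Rightarrow> 'a) \<Rightarrow> 'a \<Rightarrow> 'a" where
  "unary e x = e (\<lambda>i\<in>{1..1}. x)"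

definition neighbourhood :: "'a set \<Rightarrow> 'a oper set \<Rightarrow> 'a set \<Rightarrow> bool" where
  "neighbourhood A C U \<longleftrightarrow>
     (\<exists>e. (1, e) \<in> C \<and> (\<forall>x\<in>A. unary e (unary e x) = unary e x) \<and> U = unary e ` A)"

definition cover :: "'a set \<Rightarrow> 'a oper set \<Rightarrow> 'a set set \<Rightarrow> bool" where
  "cover A C \<U> \<longleftrightarrow>
     (\<forall>U\<in>\<U>. neighbourhood A C U) \<and>
     (\<forall>m. \<forall>r\<in>Inv A C m. \<forall>s\<in>Inv A C m.
        (\<forall>U\<in>\<U>. r \<inter> tuples m U = s \<inter> tuples m U) \<longrightarrow> r = s)"

definition irredundant :: "'a set \<Rightarrow> 'a oper set \<Rightarrow> 'a set set \<Rightarrow> bool" where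
  "irredundant A C \<U> \<longleftrightarrow> (\<forall>\<V>. \<V> \<subset> \<U> \<longrightarrow> \<not> cover A C \<V>)"

definition refines :: "'a set set \<Rightarrow> 'a set set \<Rightarrow> bool" where
  "refines \<V> \<U> \<longleftrightarrow> (\<forall>V\<in>\<V>. \<exists>U\<in>\<U>. V \<subseteq> U)"

definition proper_refinement :: "'a set set \<Rightarrow> 'a set set \<Rightarrow> bool" where
  "proper_refinement \<V> \<U> \<longleftrightarrow> refines \<V> \<U> \<and> \<not> refines \<U> \<V>"

definition non_refinable :: "'a set \<Rightarrow> 'a oper set \<Rightarrow> 'a set set \<Rightarrow> bool" where
  "non_refinable A C \<U> \<longleftrightarrow>
     \<not> (\<exists>\<V>. cover A C \<V> \<and> proper_refinement \<V> \<U>)"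

section \<open>Clones on \<open>{0,1}\<^sup>n\<close>\<close>

text \<open>The set \<open>{0,1}\<close> is the type \<^typ>\<open>bool\<close>, with \<open>0\<close> as \<^const>\<open>False\<close>.\<close>

abbreviation cube :: "nat \<Rightarrow> (nat \<Rightarrow> bool) set" where
  "cube n \<equiv> tuples n UNIV"

definition componentwise ::
  "nat \<Rightarrow> nat \<Rightarrow> (nat \<Rightarrow> (nat \<Rightarrow> bool) \<Rightarrow> bool) \<Rightarrow> (nat \<Rightarrow> (nat \<Rightarrow> bool)) \<Rightarrow> (nat \<Rightarrow> bool)" where
  "componentwise n m f =
     (\<lambda>t\<in>tuples m (cube n). \<lambda>i\<in>{1..n}. f i (\<lambda>j\<in>{1..m}. t j i))"

definition axis :: "nat \<Rightarrow> nat \<Rightarrow> (nat \<Rightarrow> bool) set" where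
  "axis n i = (\<Pi>\<^sub>E j\<in>{1..n}. if j = i then UNIV else {False})"

definition E :: "nat \<Rightarrow> (nat \<Rightarrow> bool) oper set set" where
  "E n = {C. clone (cube n) C \<and>
     (\<forall>m f. (\<forall>i\<in>{1..n}. f i \<in> operations m UNIV) \<longrightarrow> (m, componentwise n m f) \<in> C) \<and>
     cover (cube n) C (axis n ` {1..n}) \<and>
     irredundant (cube n) C (axis n ` {1..n}) \<and>
     non_refinable (cube n) C (axis n ` {1..n})}"

definition partial_orders :: "nat \<Rightarrow> nat rel set" where
  "partial_orders n = {R. partial_order_on {1..n} R}"

definition clone_order :: "nat \<Rightarrow> (nat \<Rightarrow> bool) oper set \<Rightarrow> nat rel" where
  "clone_order n C = {(i\<^sub>1, i\<^sub>2). i\<^sub>1 \<in> {1..n} \<and> i\<^sub>2 \<in> {1..n} \<and>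
     (\<forall>r. (\<forall>i\<in>{1..n}. r i \<subseteq> tuples 2 UNIV) \<and> relation_product n 2 r \<in> Inv (cube n) C 2 \<longrightarrow>
        r i\<^sub>1 = tuples 2 UNIV \<longrightarrow> r i\<^sub>2 = tuples 2 UNIV)}"

end

theory Submission
  imports Defs
begin

text \<open>Condition (a) says that a clone \<open>C\<close> contains the product of the full Boolean clones on the \<open>n\<close>
  factors, so it already has every operation that treats the coordinates separately, and every
  constant. All that is left to know about \<open>C\<close> is which coordinates of the arguments may
  influence which coordinate of the value: if some operation in \<open>C\<close> lets coordinate \<open>j\<close> influence
  coordinate \<open>i\<close>, then \<open>C\<close> contains the operation that copies \<open>j\<close> to \<open>i\<close>, and the relation
  ``\<open>j\<close> may influence \<open>i\<close>'' is a preorder. It is the relation \<open>\<le>\<^sub>C\<close>, because the kernel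
  \<open>agree n S\<close> of the projection to the coordinates in \<open>S\<close> is invariant to \<open>C\<close> exactly if \<open>S\<close>
  contains, with each \<open>i\<close>, every \<open>j\<close> that may influence \<open>i\<close>, and because the invariant products of binary
  relations are just such kernels (\<open>clone_order_iff\<close>).

  Hence the inverse map sends \<open>R\<close> to the clone \<open>order_clone n R\<close> of all operations whose coordinate
  \<open>i\<close> depends only on the coordinates \<open>j\<close> with \<open>(j, i) \<in> R\<close>. That \<open>C = order_clone n (\<le>\<^sub>C)\<close>
  for every \<open>C\<close> with (a) is \<open>rich_clone_eq_order_clone\<close>. Its nontrivial inclusion is an instance of
  the duality between clones and invariant relations: if two inputs cannot be separated at \<open>i\<close> by
  the \<open>m\<close>-ary operations of \<open>C\<close>, then they agree on all \<open>j \<le>\<^sub>C i\<close>; hence coordinate \<open>i\<close> of an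
  operation that depends only on those \<open>j\<close> is a Boolean function of the coordinates \<open>i\<close> of
  the members of \<open>C\<close>.

  Condition (b) turns preorders into partial orders. The axes cover for every \<open>C\<close> with (a), since
  an invariant relation is the product of its traces on them (\<open>axes_cover\<close>). If \<open>i \<noteq> j\<close> are
  equivalent, then copying back and forth makes the trace on axis \<open>i\<close> a copy of the trace on axis
  \<open>j\<close>, so one axis is redundant (\<open>equivalent_axis_redundant\<close>). If the preorder is antisymmetric,
  then both \<open>{j. j \<le> i}\<close> and \<open>{j. j \<le> i} - {i}\<close> are downsets, and their kernels differ only on sets
  that vary in coordinate \<open>i\<close>. So any cover that refines the axes contains every one of them
  (\<open>refining_cover_contains_axes\<close>), which yields irredundance and non-refinability at once.\<close>

\<comment> \<open>Index sets are intervals \<open>{1..n}\<close>; rewriting their left end to \<open>Suc 0\<close> would hide them from the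
  rules below.\<close>
declare One_nat_def [simp del]

section \<open>Tuples of points of the cube\<close>

lemma tuple_app: "t \<in> tuples m X \<Longrightarrow> k \<in> {1..m} \<Longrightarrow> t k \<in> X"
  by (auto simp: tuples_def)

lemma tuples_restrict: "(\<And>k. k \<in> {1..m} \<Longrightarrow> t k \<in> X) \<Longrightarrow> (\<lambda>k\<in>{1..m}. t k) \<in> tuples m X"
  by (auto simp: tuples_def)

lemma tuples_eqI:
  "s \<in> tuples m X \<Longrightarrow> t \<in> tuples m Y \<Longrightarrow> (\<And>k. k \<in> {1..m} \<Longrightarrow> s k = t k) \<Longrightarrow> s = t"
  unfolding tuples_def by (rule PiE_ext) auto

lemma tuples_restrict_id: "t \<in> tuples m X \<Longrightarrow> (\<lambda>k\<in>{1..m}. t k) = t"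
  by (auto simp: tuples_def)

lemma finite_tuples: "finite X \<Longrightarrow> finite (tuples m X)"
  by (auto simp: tuples_def intro: finite_PiE)

lemma finite_operations: "finite X \<Longrightarrow> finite (operations m X)"
  by (auto simp: operations_def intro!: finite_PiE finite_tuples)

lemma operation_app: "f \<in> operations m X \<Longrightarrow> t \<in> tuples m X \<Longrightarrow> f t \<in> X"
  by (auto simp: operations_def)

lemma operation_eqI:
  "f \<in> operations m X \<Longrightarrow> g \<in> operations m X \<Longrightarrow> (\<And>t. t \<in> tuples m X \<Longrightarrow> f t = g t) \<Longrightarrow> f = g"
  unfolding operations_def by (rule PiE_ext) auto

lemma axis_eq: "axis n i = {x \<in> cube n. \<forall>j\<in>{1..n}. j \<noteq> i \<longrightarrow> \<not> x j}"
proof (intro equalityI subsetI)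
  fix x assume "x \<in> axis n i"
  then have x: "x l \<in> (if l = i then UNIV else {False})" if "l \<in> {1..n}" for l
    using that unfolding axis_def by (rule PiE_mem)
  have "x \<in> cube n" using \<open>x \<in> axis n i\<close> by (auto simp: axis_def tuples_def PiE_iff)
  with x show "x \<in> {x \<in> cube n. \<forall>j\<in>{1..n}. j \<noteq> i \<longrightarrow> \<not> x j}" by force
qed (auto simp: axis_def tuples_def PiE_iff)

lemma pair_eqI:
  assumes "v \<in> tuples 2 X" "w \<in> tuples 2 X" "v 1 = w 1" "v 2 = w 2"
  shows "v = w"
proof (rule tuples_eqI[OF assms(1,2)])
  fix k :: nat assume "k \<in> {1..2}"
  then have "k = 1 \<or> k = 2" by auto
  then show "v k = w k" using assms(3,4) by blast
qed

section \<open>Clones containing the componentwise operations\<close>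

text \<open>Clones with condition (a).\<close>

definition rich_clone :: "nat \<Rightarrow> (nat \<Rightarrow> bool) oper set \<Rightarrow> bool" where
  "rich_clone n C \<longleftrightarrow> clone (cube n) C \<and>
     (\<forall>m f. (\<forall>i\<in>{1..n}. f i \<in> operations m UNIV) \<longrightarrow> (m, componentwise n m f) \<in> C)"

definition point :: "nat \<Rightarrow> nat \<Rightarrow> bool \<Rightarrow> nat \<Rightarrow> bool" where
  "point n i b = (\<lambda>j\<in>{1..n}. j = i \<and> b)"

lemma point_in_cube: "point n i b \<in> cube n"
  unfolding point_def by (rule tuples_restrict) auto

lemma point_in_axis: "point n i b \<in> axis n i"
  unfolding axis_eq using point_in_cube by (simp add: point_def)

lemma axis_point:
  assumes x: "x \<in> axis n i" shows "x = point n i (x i)"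
  by (rule tuples_eqI[of _ n UNIV _ UNIV])
    (use x point_in_cube[of n i "x i"] in \<open>auto simp del: atLeastAtMost_iff simp: axis_eq point_def\<close>)

lemma rich_clone_clone: "rich_clone n C \<Longrightarrow> clone (cube n) C"
  by (simp add: rich_clone_def)

lemma clone_op: "clone X C \<Longrightarrow> (m, f) \<in> C \<Longrightarrow> f \<in> operations m X"
  by (auto simp: clone_def)

lemma clone_projection: "clone X C \<Longrightarrow> k \<in> {1..m} \<Longrightarrow> (m, projection X m k) \<in> C"
  by (auto simp: clone_def)

lemma clone_compose:
  "clone X C \<Longrightarrow> (n, f) \<in> C \<Longrightarrow> (\<And>i. i \<in> {1..n} \<Longrightarrow> (m, g i) \<in> C) \<Longrightarrow> (m, compose_op X n m f g) \<in> C"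
  unfolding clone_def by blast

lemma rich_componentwise:
  assumes "rich_clone n C"
  shows "(N, \<lambda>t\<in>tuples N (cube n). \<lambda>i\<in>{1..n}. F i (\<lambda>k\<in>{1..N}. t k i)) \<in> C"
proof -
  let ?F = "\<lambda>i. \<lambda>v\<in>tuples N UNIV. F i v"
  have "(N, componentwise n N ?F) \<in> C"
    using assms by (auto simp: rich_clone_def operations_def)
  also have "componentwise n N ?F = (\<lambda>t\<in>tuples N (cube n). \<lambda>i\<in>{1..n}. F i (\<lambda>k\<in>{1..N}. t k i))"
    unfolding componentwise_def by (intro restrict_ext) (auto simp: tuples_def)
  finally show ?thesis .
qed

text \<open>Composition with the componentwise operation given by \<open>F\<close>: members of the clone may be
  recombined by a different Boolean function in each coordinate. With \<open>N = 0\<close> this gives the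
  constants.\<close>

lemma rich_clone_recombine:
  fixes N :: nat
  assumes C: "rich_clone n C" and g: "\<And>k. k \<in> {1..N} \<Longrightarrow> (m, g k) \<in> C"
  shows "(m, \<lambda>t\<in>tuples m (cube n). \<lambda>i\<in>{1..n}. F i (\<lambda>k\<in>{1..N}. g k t i)) \<in> C"
proof -
  let ?h = "\<lambda>t\<in>tuples N (cube n). \<lambda>i\<in>{1..n}. F i (\<lambda>k\<in>{1..N}. t k i)"
  have "(m, compose_op (cube n) N m ?h g) \<in> C"
    by (rule clone_compose[OF rich_clone_clone[OF C] rich_componentwise[OF C] g])
  also have "compose_op (cube n) N m ?h g =
      (\<lambda>t\<in>tuples m (cube n). \<lambda>i\<in>{1..n}. F i (\<lambda>k\<in>{1..N}. g k t i))"
    unfolding compose_op_def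
  proof (rule restrict_ext)
    fix t assume t: "t \<in> tuples m (cube n)"
    have "(\<lambda>k\<in>{1..N}. g k t) \<in> tuples N (cube n)"
      using operation_app[OF clone_op[OF rich_clone_clone[OF C] g] t] by (rule tuples_restrict)
    then show "?h (\<lambda>k\<in>{1..N}. g k t) = (\<lambda>i\<in>{1..n}. F i (\<lambda>k\<in>{1..N}. g k t i))"
      by (auto intro!: restrict_ext arg_cong[where f = "F _"])
  qed
  finally show ?thesis .
qed

lemma Inv_apply:
  assumes "r \<in> Inv X C m" and "(N, f) \<in> C" and "\<And>k. k \<in> {1..N} \<Longrightarrow> x k \<in> r"
  shows "(\<lambda>j\<in>{1..m}. f (\<lambda>k\<in>{1..N}. x k j)) \<in> r"
proof -
  have "invariant m r C" using assms(1) by (simp add: Inv_def)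
  then have "\<forall>t. (\<forall>k\<in>{1..N}. t k \<in> r) \<longrightarrow> (\<lambda>j\<in>{1..m}. f (\<lambda>k\<in>{1..N}. t k j)) \<in> r"
    using assms(2) unfolding invariant_def by (auto dest: bspec)
  then show ?thesis using assms(3) by blast
qed

lemma Inv_subset: "r \<in> Inv X C m \<Longrightarrow> r \<subseteq> tuples m X"
  by (simp add: Inv_def)

text \<open>The same recombination for the tuples of an invariant relation, which makes such a relation a
  product over the coordinates.\<close>

lemma Inv_recombine:
  fixes N :: nat
  assumes C: "rich_clone n C" and r: "r \<in> Inv (cube n) C m"
    and x: "\<And>k. k \<in> {1..N} \<Longrightarrow> x k \<in> r"
  shows "(\<lambda>j\<in>{1..m}. \<lambda>i\<in>{1..n}. F i (\<lambda>k\<in>{1..N}. x k j i)) \<in> r"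
proof -
  let ?h = "\<lambda>t\<in>tuples N (cube n). \<lambda>i\<in>{1..n}. F i (\<lambda>k\<in>{1..N}. t k i)"
  have "(\<lambda>j\<in>{1..m}. ?h (\<lambda>k\<in>{1..N}. x k j)) \<in> r"
    using Inv_apply[OF r rich_componentwise[OF C] x] .
  also have "(\<lambda>j\<in>{1..m}. ?h (\<lambda>k\<in>{1..N}. x k j)) =
      (\<lambda>j\<in>{1..m}. \<lambda>i\<in>{1..n}. F i (\<lambda>k\<in>{1..N}. x k j i))"
  proof (rule restrict_ext)
    fix j assume j: "j \<in> {1..m}"
    have "(\<lambda>k\<in>{1..N}. x k j) \<in> tuples N (cube n)"
      using tuple_app[OF subsetD[OF Inv_subset[OF r] x] j] by (rule tuples_restrict)
    then show "?h (\<lambda>k\<in>{1..N}. x k j) = (\<lambda>i\<in>{1..n}. F i (\<lambda>k\<in>{1..N}. x k j i))"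
      by (auto intro!: restrict_ext arg_cong[where f = "F _"])
  qed
  finally show ?thesis .
qed

section \<open>The axes cover\<close>

definition axis_part :: "nat \<Rightarrow> nat \<Rightarrow> nat \<Rightarrow> (nat \<Rightarrow> nat \<Rightarrow> bool) \<Rightarrow> nat \<Rightarrow> nat \<Rightarrow> bool" where
  "axis_part n m i x = (\<lambda>j\<in>{1..m}. point n i (x j i))"

lemma axis_part_in_axis: "axis_part n m i x \<in> tuples m (axis n i)"
  unfolding axis_part_def
  by (rule tuples_restrict) (rule point_in_axis)

text \<open>The map that resets all coordinates but \<open>i\<close> is componentwise, and so is the \<open>n\<close>-ary operation
  that takes coordinate \<open>i\<close> of its \<open>i\<close>-th argument: the former takes a tuple apart along the axes,
  the latter puts it together again.\<close>

lemma Inv_iff_axis_parts: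
  assumes C: "rich_clone n C" and r: "r \<in> Inv (cube n) C m" and x: "x \<in> tuples m (cube n)"
  shows "x \<in> r \<longleftrightarrow> (\<forall>i\<in>{1..n}. axis_part n m i x \<in> r)"
proof
  assume xr: "x \<in> r"
  show "\<forall>i\<in>{1..n}. axis_part n m i x \<in> r"
  proof
    fix i assume i: "i \<in> {1..n}"
    have "(\<lambda>j\<in>{1..m}. \<lambda>l\<in>{1..n}. (\<lambda>v. l = i \<and> v 1) (\<lambda>k\<in>{1..1::nat}. x j l)) \<in> r"
      by (rule Inv_recombine[OF C r, where x = "\<lambda>_. x"]) (use xr in auto)
    also have "(\<lambda>j\<in>{1..m}. \<lambda>l\<in>{1..n}. (\<lambda>v. l = i \<and> v 1) (\<lambda>k\<in>{1..1::nat}. x j l))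
        = axis_part n m i x"
      unfolding axis_part_def point_def by (intro restrict_ext) auto
    finally show "axis_part n m i x \<in> r" .
  qed
next
  assume "\<forall>i\<in>{1..n}. axis_part n m i x \<in> r"
  then have "(\<lambda>j\<in>{1..m}. \<lambda>l\<in>{1..n}. (\<lambda>v. v l) (\<lambda>k\<in>{1..n}. axis_part n m k x j l)) \<in> r"
    by (intro Inv_recombine[OF C r]) auto
  also have "(\<lambda>j\<in>{1..m}. \<lambda>l\<in>{1..n}. (\<lambda>v. v l) (\<lambda>k\<in>{1..n}. axis_part n m k x j l)) = x"
    (is "?y = x")
  proof (rule tuples_eqI)
    show "?y \<in> tuples m (cube n)" by (intro tuples_restrict) auto
    fix j assume j: "j \<in> {1..m}"
    show "?y j = x j"
      by (rule tuples_eqI[OF _ tuple_app[OF x j], where X = UNIV])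
        (use j in \<open>auto intro!: tuples_restrict simp: axis_part_def point_def\<close>)
  qed (rule x)
  finally show "x \<in> r" .
qed

lemma axis_neighbourhood:
  assumes C: "rich_clone n C" and i: "i \<in> {1..n}"
  shows "neighbourhood (cube n) C (axis n i)"
proof -
  let ?e = "\<lambda>t\<in>tuples 1 (cube n). \<lambda>l\<in>{1..n}. (\<lambda>v. l = i \<and> v 1) (\<lambda>k\<in>{1..1::nat}. t k l)"
  have e: "unary ?e x = point n i (x i)" if "x \<in> cube n" for x
  proof -
    have "(\<lambda>k\<in>{1..1::nat}. x) \<in> tuples 1 (cube n)"
      using that by (intro tuples_restrict)
    then show ?thesis by (auto simp: unary_def point_def intro!: restrict_ext)
  qed
  have "\<forall>x\<in>cube n. unary ?e (unary ?e x) = unary ?e x"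
  proof
    fix x assume x: "x \<in> cube n"
    show "unary ?e (unary ?e x) = unary ?e x"
      unfolding e[OF x] e[OF point_in_cube] using i by (simp add: point_def)
  qed
  moreover have "axis n i = unary ?e ` cube n"
  proof -
    have "axis n i = (\<lambda>x. point n i (x i)) ` cube n"
    proof (intro equalityI subsetI)
      fix x assume x: "x \<in> axis n i"
      then have "x \<in> cube n" by (simp add: axis_eq)
      then show "x \<in> (\<lambda>x. point n i (x i)) ` cube n"
        by (rule rev_image_eqI) (rule axis_point[OF x])
    qed (use point_in_axis in auto)
    also have "\<dots> = unary ?e ` cube n" by (rule image_cong) (simp_all only: e)
    finally show ?thesis .
  qed
  ultimately show ?thesis
    unfolding neighbourhood_def using rich_componentwise[OF C] by (intro exI[of _ ?e] conjI)
qed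

lemma coverD:
  assumes "cover A C \<U>" "r \<in> Inv A C m" "s \<in> Inv A C m"
    and "\<And>U. U \<in> \<U> \<Longrightarrow> r \<inter> tuples m U = s \<inter> tuples m U"
  shows "r = s"
proof -
  have "\<forall>r\<in>Inv A C m. \<forall>s\<in>Inv A C m. (\<forall>U\<in>\<U>. r \<inter> tuples m U = s \<inter> tuples m U) \<longrightarrow> r = s"
    using assms(1) unfolding cover_def by (elim conjE) (rule spec)
  from mp[OF bspec[OF bspec[OF this assms(2)] assms(3)]] show ?thesis using assms(4) by simp
qed

lemma axes_cover:
  assumes C: "rich_clone n C" shows "cover (cube n) C (axis n ` {1..n})"
  unfolding cover_def
proof (intro conjI allI ballI impI)
  fix U assume "U \<in> axis n ` {1..n}"
  then show "neighbourhood (cube n) C U" using axis_neighbourhood[OF C] by auto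
next
  fix m r s assume r: "r \<in> Inv (cube n) C m" and s: "s \<in> Inv (cube n) C m"
    and eq: "\<forall>U\<in>axis n ` {1..n}. r \<inter> tuples m U = s \<inter> tuples m U"
  have part: "axis_part n m i x \<in> r \<longleftrightarrow> axis_part n m i x \<in> s" if "i \<in> {1..n}" for i x
    using eq that axis_part_in_axis[of n m i x] by blast
  have "x \<in> r \<longleftrightarrow> x \<in> s" if x: "x \<in> tuples m (cube n)" for x
    unfolding Inv_iff_axis_parts[OF C r x] Inv_iff_axis_parts[OF C s x]
    using part by simp
  then show "r = s" using Inv_subset[OF r] Inv_subset[OF s] by (meson subsetD subset_antisym subsetI)
qed

section \<open>Which coordinates of the arguments determine a coordinate of the value\<close>

definition determined :: "nat \<Rightarrow> nat \<Rightarrow> ((nat \<Rightarrow> nat \<Rightarrow> bool) \<Rightarrow> nat \<Rightarrow> bool) \<Rightarrow> nat set \<Rightarrow> nat \<Rightarrow> bool" where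
  "determined n m f S i \<longleftrightarrow>
     (\<forall>x\<in>tuples m (cube n). \<forall>y\<in>tuples m (cube n).
        (\<forall>k\<in>{1..m}. \<forall>j\<in>S. x k j = y k j) \<longrightarrow> f x i = f y i)"

lemma determinedD:
  assumes D: "determined n m f S i" and x: "x \<in> tuples m (cube n)" and y: "y \<in> tuples m (cube n)"
    and eq: "\<And>k j. k \<in> {1..m} \<Longrightarrow> j \<in> S \<Longrightarrow> x k j = y k j"
  shows "f x i = f y i"
proof -
  have "(\<forall>k\<in>{1..m}. \<forall>j\<in>S. x k j = y k j) \<longrightarrow> f x i = f y i"
    using bspec[OF bspec[OF D[unfolded determined_def] x] y] .
  then show ?thesis by (rule mp) (intro ballI eq)
qed

lemma determined_mono:
  assumes S: "determined n m f S i" and sub: "S \<subseteq> T"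
  shows "determined n m f T i"
  unfolding determined_def
proof (intro ballI impI)
  fix x y assume x: "x \<in> tuples m (cube n)" and y: "y \<in> tuples m (cube n)"
    and eq: "\<forall>k\<in>{1..m}. \<forall>j\<in>T. x k j = y k j"
  show "f x i = f y i"
  proof (rule determinedD[OF S x y])
    fix k j assume "k \<in> {1..m}" "j \<in> S"
    then show "x k j = y k j" using eq subsetD[OF sub] by simp
  qed
qed

lemma determined_all: "determined n m f {1..n} i"
  unfolding determined_def
proof (intro ballI impI)
  fix x y assume x: "x \<in> tuples m (cube n)" and y: "y \<in> tuples m (cube n)"
    and eq: "\<forall>k\<in>{1..m}. \<forall>j\<in>{1..n}. x k j = y k j"
  have "x = y"
  proof (rule tuples_eqI[OF x y])
    fix k assume k: "k \<in> {1..m}"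
    show "x k = y k"
      by (rule tuples_eqI[OF tuple_app[OF x k] tuple_app[OF y k]]) (use eq k in auto)
  qed
  then show "f x i = f y i" by simp
qed

text \<open>Between arguments that agree on the intersection, interpolate one that agrees with the
  first on one set and with the second on the other.\<close>

lemma determined_Int:
  assumes S: "determined n m f S i" and T: "determined n m f T i" and sub: "S \<subseteq> {1..n}" "T \<subseteq> {1..n}"
  shows "determined n m f (S \<inter> T) i"
  unfolding determined_def
proof (intro ballI impI)
  fix x y assume x: "x \<in> tuples m (cube n)" and y: "y \<in> tuples m (cube n)"
    and eq: "\<forall>k\<in>{1..m}. \<forall>j\<in>S \<inter> T. x k j = y k j"
  define z where "z = (\<lambda>k\<in>{1..m}. \<lambda>j\<in>{1..n}. if j \<in> S then x k j else y k j)"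
  have z: "z \<in> tuples m (cube n)" unfolding z_def by (intro tuples_restrict) auto
  have "f x i = f z i"
  proof (rule determinedD[OF S x z])
    fix k j assume "k \<in> {1..m}" "j \<in> S"
    then show "x k j = z k j" using subsetD[OF sub(1)] by (simp add: z_def)
  qed
  also have "\<dots> = f y i"
  proof (rule determinedD[OF T z y])
    fix k j assume "k \<in> {1..m}" "j \<in> T"
    then show "z k j = y k j" using subsetD[OF sub(2)] eq by (simp add: z_def)
  qed
  finally show "f x i = f y i" .
qed

lemma determined_Inter:
  assumes "finite \<F>" "\<F> \<noteq> {}" "\<And>S. S \<in> \<F> \<Longrightarrow> S \<subseteq> {1..n} \<and> determined n m f S i"
  shows "determined n m f (\<Inter>\<F>) i"
  using assms
proof (induction \<F> rule: finite_ne_induct)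
  case (insert S \<F>)
  have "determined n m f (S \<inter> \<Inter>\<F>) i"
    by (rule determined_Int) (use insert in auto)
  then show ?case by simp
qed auto

text \<open>The kernel of the projection to the coordinates in \<open>S\<close>, as a set of pairs.\<close>

definition agree :: "nat \<Rightarrow> nat set \<Rightarrow> (nat \<Rightarrow> nat \<Rightarrow> bool) set" where
  "agree n S = {p \<in> tuples 2 (cube n). \<forall>i\<in>S. p 1 i = p 2 i}"

text \<open>Feeding \<open>m\<close> pairs of a kernel to an \<open>m\<close>-ary operation means evaluating it at two inputs that
  agree on \<open>S\<close>.\<close>

lemma agree_Inv_iff:
  assumes ops: "\<And>m f. (m, f) \<in> C \<Longrightarrow> f \<in> operations m (cube n)"
  shows "agree n S \<in> Inv (cube n) C 2 \<longleftrightarrow> (\<forall>(m, f)\<in>C. \<forall>i\<in>S. determined n m f S i)"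
proof
  assume inv: "agree n S \<in> Inv (cube n) C 2"
  show "\<forall>(m, f)\<in>C. \<forall>i\<in>S. determined n m f S i"
  proof (clarify)
    fix m f i assume f: "(m, f) \<in> C" and i: "i \<in> S"
    show "determined n m f S i"
      unfolding determined_def
    proof (intro ballI impI)
      fix x y assume x: "x \<in> tuples m (cube n)" and y: "y \<in> tuples m (cube n)"
        and eq: "\<forall>k\<in>{1..m}. \<forall>j\<in>S. x k j = y k j"
      define p where "p k = (\<lambda>a\<in>{1..2::nat}. if a = 1 then x k else y k)" for k
      have p: "p k \<in> agree n S" if "k \<in> {1..m}" for k
      proof -
        have "p k \<in> tuples 2 (cube n)"
          unfolding p_def using tuple_app[OF x that] tuple_app[OF y that]
          by (intro tuples_restrict) auto
        then show ?thesis using eq that by (auto simp: agree_def p_def)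
      qed
      have "(\<lambda>a\<in>{1..2}. f (\<lambda>k\<in>{1..m}. p k a)) \<in> agree n S"
        by (rule Inv_apply[OF inv f p])
      moreover have "(\<lambda>k\<in>{1..m}. p k 1) = x" "(\<lambda>k\<in>{1..m}. p k 2) = y"
        using tuples_restrict_id[OF x] tuples_restrict_id[OF y] by (simp_all add: p_def)
      ultimately show "f x i = f y i" using i by (simp add: agree_def)
    qed
  qed
next
  assume det: "\<forall>(m, f)\<in>C. \<forall>i\<in>S. determined n m f S i"
  have "(\<lambda>j\<in>{1..2}. f (\<lambda>k\<in>{1..m}. t k j)) \<in> agree n S"
    if f: "(m, f) \<in> C" and t: "\<forall>k\<in>{1..m}. t k \<in> agree n S" for m f t
  proof -
    let ?x = "\<lambda>j. \<lambda>k\<in>{1..m}. t k j"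
    have x: "?x j \<in> tuples m (cube n)" if "j \<in> {1..2}" for j
    proof (rule tuples_restrict)
      fix k assume "k \<in> {1..m}"
      then have "t k \<in> tuples 2 (cube n)" using t by (simp add: agree_def)
      then show "t k j \<in> cube n" by (rule tuple_app[OF _ that])
    qed
    have "f (?x 1) i = f (?x 2) i" if "i \<in> S" for i
    proof (rule determinedD[of n m f S i])
      show "determined n m f S i" using det f that by blast
    qed (use x t in \<open>auto simp: agree_def\<close>)
    moreover have "(\<lambda>j\<in>{1..2}. f (?x j)) \<in> tuples 2 (cube n)"
      by (intro tuples_restrict operation_app[OF ops[OF f]] x)
    ultimately show ?thesis by (simp add: agree_def)
  qed
  then show "agree n S \<in> Inv (cube n) C 2"
    unfolding Inv_def invariant_def by (auto simp: agree_def)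
qed

section \<open>The order of a clone in terms of its invariant agreement relations\<close>

lemma relation_product_iff:
  assumes r: "\<And>i. i \<in> {1..n} \<Longrightarrow> r i \<subseteq> tuples m UNIV"
  shows "p \<in> relation_product n m r \<longleftrightarrow>
    p \<in> tuples m (cube n) \<and> (\<forall>i\<in>{1..n}. (\<lambda>j\<in>{1..m}. p j i) \<in> r i)"
proof
  assume "p \<in> relation_product n m r"
  then obtain x where p: "p = (\<lambda>j\<in>{1..m}. \<lambda>i\<in>{1..n}. x i j)" and x: "\<forall>i\<in>{1..n}. x i \<in> r i"
    by (auto simp: relation_product_def)
  have "(\<lambda>j\<in>{1..m}. p j i) = x i" if "i \<in> {1..n}" for i
    by (rule tuples_eqI[where X = UNIV and Y = UNIV and m = m])
      (use that x subsetD[OF r[OF that]] p in \<open>auto intro!: tuples_restrict\<close>)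
  moreover have "p \<in> tuples m (cube n)" unfolding p by (intro tuples_restrict) auto
  ultimately show "p \<in> tuples m (cube n) \<and> (\<forall>i\<in>{1..n}. (\<lambda>j\<in>{1..m}. p j i) \<in> r i)"
    using x by simp
next
  assume p: "p \<in> tuples m (cube n) \<and> (\<forall>i\<in>{1..n}. (\<lambda>j\<in>{1..m}. p j i) \<in> r i)"
  have "p = (\<lambda>j\<in>{1..m}. \<lambda>i\<in>{1..n}. (\<lambda>j\<in>{1..m}. p j i) j)" (is "p = ?q")
  proof (rule tuples_eqI)
    show "p \<in> tuples m (cube n)" using p by simp
    show "?q \<in> tuples m (cube n)" by (intro tuples_restrict) auto
    fix j assume j: "j \<in> {1..m}"
    show "p j = ?q j"
      by (rule tuples_eqI[of _ n UNIV _ UNIV])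
        (use p j tuple_app[of p m "cube n" j] in \<open>auto intro!: tuples_restrict\<close>)
  qed
  then show "p \<in> relation_product n m r" unfolding relation_product_def using p
    by (intro CollectI exI[of _ "\<lambda>i. \<lambda>j\<in>{1..m}. p j i"] conjI) simp_all
qed

definition diag :: "(nat \<Rightarrow> bool) set" where
  "diag = {v \<in> tuples 2 UNIV. v 1 = v 2}"

lemma diag_not_full: "diag \<noteq> tuples 2 UNIV"
proof
  assume "diag = tuples 2 UNIV"
  moreover have "(\<lambda>j\<in>{1..2::nat}. j = 1) \<in> tuples 2 UNIV" by (rule tuples_restrict) auto
  ultimately have "(\<lambda>j\<in>{1..2::nat}. j = 1) \<in> diag" by simp
  then show False by (simp add: diag_def)
qed

lemma agree_as_product:
  assumes "S \<subseteq> {1..n}"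
  shows "relation_product n 2 (\<lambda>i. if i \<in> S then diag else tuples 2 UNIV) = agree n S"
    (is "relation_product n 2 ?r = _")
proof -
  have "?r i \<subseteq> tuples 2 UNIV" for i by (auto simp: diag_def)
  note iff = relation_product_iff[of n ?r 2, OF this]
  have v: "(\<lambda>j\<in>{1..2}. p j i) \<in> tuples 2 UNIV" for p :: "nat \<Rightarrow> nat \<Rightarrow> bool" and i
    by (rule tuples_restrict) auto
  show ?thesis
  proof (rule set_eqI)
    fix p
    have "(\<lambda>j\<in>{1..2}. p j i) \<in> ?r i \<longleftrightarrow> (i \<in> S \<longrightarrow> p 1 i = p 2 i)" for i
      using v by (simp add: diag_def)
    then show "p \<in> relation_product n 2 ?r \<longleftrightarrow> p \<in> agree n S"
      using assms by (auto simp: iff agree_def)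
  qed
qed

text \<open>The factors of an invariant product contain the diagonal because constants are operations,
  and a factor with an off-diagonal pair also contains the negated pair; so a factor is the diagonal or full.\<close>

lemma invariant_product_is_agree:
  assumes C: "rich_clone n C" and r: "\<And>i. i \<in> {1..n} \<Longrightarrow> r i \<subseteq> tuples 2 UNIV"
    and inv: "relation_product n 2 r \<in> Inv (cube n) C 2"
  shows "relation_product n 2 r = agree n {i \<in> {1..n}. r i \<noteq> tuples 2 UNIV}"
proof -
  let ?P = "relation_product n 2 r"
  note iff = relation_product_iff[of n r 2, OF r]
  \<comment> \<open>The nullary case of recombination.\<close>
  have const: "(\<lambda>j\<in>{1..2}. b) \<in> r i" if i: "i \<in> {1..n}" for i b
  proof -
    have "(\<lambda>j\<in>{1..2}. \<lambda>i\<in>{1..n}. (\<lambda>_. b) (\<lambda>k\<in>{1..0::nat}. (\<lambda>_ _ _. False) k j i)) \<in> ?P"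
      by (rule Inv_recombine[OF C inv]) auto
    then have "(\<lambda>j\<in>{1..2}. \<lambda>i\<in>{1..n}. b) \<in> ?P" by simp
    then have "(\<lambda>j\<in>{1..2}. (\<lambda>j\<in>{1..2}. \<lambda>i\<in>{1..n}. b) j i) \<in> r i" using i iff by blast
    also have "(\<lambda>j\<in>{1..2}. (\<lambda>j\<in>{1..2}. \<lambda>i\<in>{1..n}. b) j i) = (\<lambda>j\<in>{1..2}. b)"
      using i by (intro restrict_ext) auto
    finally show ?thesis .
  qed
  have r_diag: "r i = diag" if i: "i \<in> {1..n}" and ne: "r i \<noteq> tuples 2 UNIV" for i
  proof -
    have "v 1 = v 2" if v: "v \<in> r i" for v
    proof (rule ccontr)
      assume off: "v 1 \<noteq> v 2"
      have vt: "v \<in> tuples 2 UNIV" using v r[OF i] by blast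
      \<comment> \<open>The pair \<open>v\<close> in factor \<open>i\<close>, padded with zeros; negating it everywhere negates \<open>v\<close>.\<close>
      define p where "p = (\<lambda>j\<in>{1..2::nat}. point n i (v j))"
      have pt: "p \<in> tuples 2 (cube n)" unfolding p_def by (intro tuples_restrict point_in_cube)
      have pl: "(\<lambda>j\<in>{1..2}. p j l) = (if l = i then v else (\<lambda>j\<in>{1..2}. False))" if "l \<in> {1..n}" for l
      proof (cases "l = i")
        case True
        have "(\<lambda>j\<in>{1..2}. p j i) = (\<lambda>j\<in>{1..2}. v j)"
          using i by (intro restrict_ext) (simp add: p_def point_def)
        then show ?thesis using True tuples_restrict_id[OF vt] by simp
      next
        case False
        then show ?thesis using that by (auto simp: p_def point_def intro!: restrict_ext)
      qed
      have "p \<in> ?P" using pt pl v const iff by auto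
      then have "(\<lambda>j\<in>{1..2}. \<lambda>l\<in>{1..n}. (\<lambda>w. \<not> w 1) (\<lambda>k\<in>{1..1::nat}. p j l)) \<in> ?P"
        by (intro Inv_recombine[OF C inv, where x = "\<lambda>_. p"]) auto
      then have "(\<lambda>j\<in>{1..2}. (\<lambda>j\<in>{1..2}. \<lambda>l\<in>{1..n}. (\<lambda>w. \<not> w 1) (\<lambda>k\<in>{1..1::nat}. p j l)) j i) \<in> r i"
        using iff i by blast
      also have "(\<lambda>j\<in>{1..2}. (\<lambda>j\<in>{1..2}. \<lambda>l\<in>{1..n}. (\<lambda>w. \<not> w 1) (\<lambda>k\<in>{1..1::nat}. p j l)) j i)
          = (\<lambda>j\<in>{1..2}. \<not> v j)"
        using i by (intro restrict_ext) (auto simp: p_def point_def)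
      finally have neg: "(\<lambda>j\<in>{1..2}. \<not> v j) \<in> r i" .
      have "w \<in> r i" if w: "w \<in> tuples 2 UNIV" for w
      proof -
        have cases4: "w = v \<or> w = (\<lambda>j\<in>{1..2}. \<not> v j) \<or> w = (\<lambda>j\<in>{1..2}. w 1)"
        proof -
          have E: "w = u" if "u \<in> tuples 2 UNIV" "w 1 = u 1" "w 2 = u 2" for u
            by (rule pair_eqI[OF w that])
          have n: "(\<lambda>j\<in>{1..2}. \<not> v j) \<in> tuples 2 UNIV" "(\<lambda>j\<in>{1..2}. w 1) \<in> tuples 2 UNIV"
            by (auto intro!: tuples_restrict)
          show ?thesis using E[OF vt] E[OF n(1)] E[OF n(2)] off by auto
        qed
        then show ?thesis using v neg const[OF i, of "w 1"] by metis
      qed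
      then show False using ne r[OF i] by blast
    qed
    moreover have "v \<in> r i" if "v \<in> tuples 2 UNIV" "v 1 = v 2" for v
    proof -
      have "v = (\<lambda>j\<in>{1..2}. v 1)"
        by (rule pair_eqI[OF that(1)]) (use that in \<open>auto intro!: tuples_restrict\<close>)
      then show ?thesis using const[OF i] by metis
    qed
    ultimately show ?thesis using r[OF i] unfolding diag_def by blast
  qed
  let ?S = "{i \<in> {1..n}. r i \<noteq> tuples 2 UNIV}"
  have "?P = relation_product n 2 (\<lambda>i. if i \<in> ?S then diag else tuples 2 UNIV)"
    unfolding relation_product_def using r_diag by (intro Collect_cong ex_cong conj_cong refl ball_cong) auto
  also have "\<dots> = agree n ?S" by (rule agree_as_product) auto
  finally show ?thesis .
qed

text \<open>The two preceding facts translate between invariant products and invariant kernels: the factors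
  that are not full are those with index in \<open>S\<close>.\<close>

lemma clone_order_iff:
  assumes C: "rich_clone n C"
  shows "(i, i') \<in> clone_order n C \<longleftrightarrow> i \<in> {1..n} \<and> i' \<in> {1..n} \<and>
    (\<forall>S\<subseteq>{1..n}. agree n S \<in> Inv (cube n) C 2 \<longrightarrow> i' \<in> S \<longrightarrow> i \<in> S)"
proof (intro iffI conjI allI impI)
  assume o: "(i, i') \<in> clone_order n C"
  then show i: "i \<in> {1..n}" "i' \<in> {1..n}" by (auto simp: clone_order_def)
  fix S assume S: "S \<subseteq> {1..n}" "agree n S \<in> Inv (cube n) C 2" "i' \<in> S"
  let ?r = "\<lambda>i. if i \<in> S then diag else tuples 2 UNIV"
  have sub: "\<forall>i\<in>{1..n}. ?r i \<subseteq> tuples 2 UNIV" by (auto simp: diag_def)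
  have inv: "relation_product n 2 ?r \<in> Inv (cube n) C 2"
    using S(2) unfolding agree_as_product[OF S(1)] .
  have "?r i = tuples 2 UNIV \<longrightarrow> ?r i' = tuples 2 UNIV"
  proof -
    have "\<forall>r. (\<forall>i\<in>{1..n}. r i \<subseteq> tuples 2 UNIV) \<and>
        relation_product n 2 r \<in> Inv (cube n) C 2 \<longrightarrow>
        r i = tuples 2 UNIV \<longrightarrow> r i' = tuples 2 UNIV"
      using o by (simp add: clone_order_def)
    from mp[OF spec[OF this] conjI[OF sub inv]] show ?thesis .
  qed
  then show "i \<in> S" using S(3) diag_not_full by (cases "i \<in> S") simp_all
next
  assume R: "i \<in> {1..n} \<and> i' \<in> {1..n} \<and>
    (\<forall>S\<subseteq>{1..n}. agree n S \<in> Inv (cube n) C 2 \<longrightarrow> i' \<in> S \<longrightarrow> i \<in> S)"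
  have "r i' = tuples 2 UNIV" if r: "\<forall>i\<in>{1..n}. r i \<subseteq> tuples 2 UNIV"
    "relation_product n 2 r \<in> Inv (cube n) C 2" "r i = tuples 2 UNIV" for r
  proof -
    define T where "T = {i \<in> {1..n}. r i \<noteq> tuples 2 UNIV}"
    have "agree n T \<in> Inv (cube n) C 2"
      using invariant_product_is_agree[OF C bspec[OF r(1)] r(2)] r(2) by (simp add: T_def)
    moreover have "T \<subseteq> {1..n}" by (auto simp: T_def)
    ultimately have "i' \<in> T \<longrightarrow> i \<in> T" using R by blast
    then show ?thesis using R r(3) by (simp add: T_def)
  qed
  then show "(i, i') \<in> clone_order n C"
    using R unfolding clone_order_def by (intro CollectI case_prodI conjI allI impI) blast+
qed

lemma clone_order_mem:
  "rich_clone n C \<Longrightarrow> (i, i') \<in> clone_order n C \<Longrightarrow> S \<subseteq> {1..n} \<Longrightarrow>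
    agree n S \<in> Inv (cube n) C 2 \<Longrightarrow> i' \<in> S \<Longrightarrow> i \<in> S"
  using clone_order_iff[of n C i i'] by simp

section \<open>A rich clone is determined by its order\<close>

text \<open>The largest clone in which only coordinates below \<open>i\<close> influence coordinate \<open>i\<close>, if \<open>R\<close> is a
  preorder; as a map on partial orders, the inverse of \<open>clone_order n\<close>.\<close>

definition order_clone :: "nat \<Rightarrow> nat rel \<Rightarrow> (nat \<Rightarrow> bool) oper set" where
  "order_clone n R =
     {(m, f). f \<in> operations m (cube n) \<and> (\<forall>i\<in>{1..n}. determined n m f {j. (j, i) \<in> R} i)}"

lemma order_clone_op: "(m, f) \<in> order_clone n R \<Longrightarrow> f \<in> operations m (cube n)"
  by (simp add: order_clone_def)

lemma order_clone_determined:
  "(m, f) \<in> order_clone n R \<Longrightarrow> i \<in> {1..n} \<Longrightarrow> determined n m f {j. (j, i) \<in> R} i"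
  unfolding order_clone_def by blast

lemma order_cloneI:
  "f \<in> operations m (cube n) \<Longrightarrow>
    (\<And>i. i \<in> {1..n} \<Longrightarrow> determined n m f {j. (j, i) \<in> R} i) \<Longrightarrow> (m, f) \<in> order_clone n R"
  unfolding order_clone_def by blast

text \<open>Separation at each coordinate where \<open>p\<close> and \<open>q\<close> differ suffices to reach \<open>(p, q)\<close>: the separating
  operations may be chosen independently for the coordinates, and Boolean functions then
  turn the two values that they take into the prescribed ones.\<close>

lemma rich_clone_interpolate:
  assumes C: "rich_clone n C"
    and p: "p \<in> cube n" and q: "q \<in> cube n"
    and x: "x \<in> tuples m (cube n)" and y: "y \<in> tuples m (cube n)"
    and agr: "\<And>j. j \<in> {1..n} \<Longrightarrow> p j \<noteq> q j \<Longrightarrow> \<exists>g. (m, g) \<in> C \<and> g x j \<noteq> g y j"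
  shows "\<exists>g. (m, g) \<in> C \<and> g x = p \<and> g y = q"
proof -
  \<comment> \<open>A constant serves at the coordinates where nothing has to be separated.\<close>
  have "(m, \<lambda>t\<in>tuples m (cube n). \<lambda>i\<in>{1..n}. (\<lambda>_. False) (\<lambda>k\<in>{1..0::nat}. (\<lambda>_ _ _. False) k t i)) \<in> C"
    by (rule rich_clone_recombine[OF C]) auto
  then have "\<forall>j\<in>{1..n}. \<exists>g. (m, g) \<in> C \<and> (p j \<noteq> q j \<longrightarrow> g x j \<noteq> g y j)"
    using agr by blast
  then obtain w where w: "\<And>j. j \<in> {1..n} \<Longrightarrow> (m, w j) \<in> C"
    and sep: "\<And>j. j \<in> {1..n} \<Longrightarrow> p j \<noteq> q j \<Longrightarrow> w j x j \<noteq> w j y j" by metis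
  let ?F = "\<lambda>j v. if v j = w j x j then p j else q j"
  let ?g = "\<lambda>t\<in>tuples m (cube n). \<lambda>j\<in>{1..n}. ?F j (\<lambda>k\<in>{1..n}. w k t j)"
  have "(m, ?g) \<in> C" by (rule rich_clone_recombine[OF C w])
  moreover have "?g x = p"
    by (rule tuples_eqI[OF _ p, where X = UNIV]) (use x in \<open>auto intro!: tuples_restrict\<close>)
  moreover have "?g y = q"
    by (rule tuples_eqI[OF _ q, where X = UNIV]) (use y sep in \<open>auto intro!: tuples_restrict\<close>)
  ultimately show ?thesis by blast
qed

text \<open>By interpolation, the pairs \<open>(g x, g y)\<close> with \<open>g\<close> an \<open>m\<close>-ary member of \<open>C\<close> are exactly the kernel
  of the projection to the coordinates at which no \<open>g\<close> separates \<open>x\<close> from \<open>y\<close>; and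
  they are invariant because \<open>C\<close> is closed under composition.\<close>

lemma agree_of_pair_Inv:
  assumes C: "rich_clone n C"
    and x: "x \<in> tuples m (cube n)" and y: "y \<in> tuples m (cube n)"
  shows "agree n {j \<in> {1..n}. \<forall>g. (m, g) \<in> C \<longrightarrow> g x j = g y j} \<in> Inv (cube n) C 2"
    (is "agree n ?S \<in> _")
proof -
  note cl = rich_clone_clone[OF C]
  have "determined n m' f ?S i" if f: "(m', f) \<in> C" and i: "i \<in> ?S" for m' f i
    unfolding determined_def
  proof (intro ballI impI)
    fix x' y' assume x': "x' \<in> tuples m' (cube n)" and y': "y' \<in> tuples m' (cube n)"
      and eq: "\<forall>k\<in>{1..m'}. \<forall>j\<in>?S. x' k j = y' k j"
    have "\<exists>g. (m, g) \<in> C \<and> g x = x' k \<and> g y = y' k" if k: "k \<in> {1..m'}" for k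
      by (rule rich_clone_interpolate[OF C tuple_app[OF x' k] tuple_app[OF y' k] x y])
        (use eq k in blast)
    then obtain g where g: "\<And>k. k \<in> {1..m'} \<Longrightarrow> (m, g k) \<in> C \<and> g k x = x' k \<and> g k y = y' k"
      by metis
    let ?h = "compose_op (cube n) m' m f g"
    have "(m, ?h) \<in> C" using clone_compose[OF cl f] g by blast
    then have "?h x i = ?h y i" using i by blast
    moreover have "(\<lambda>k\<in>{1..m'}. g k x) = x'" "(\<lambda>k\<in>{1..m'}. g k y) = y'"
      using g tuples_restrict_id[OF x'] tuples_restrict_id[OF y']
      by (metis (mono_tags, lifting) restrict_ext)+
    ultimately show "f x' i = f y' i" using x y by (simp add: compose_op_def)
  qed
  then show ?thesis using agree_Inv_iff[OF clone_op[OF cl]] by blast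
qed

text \<open>For \<open>C \<subseteq> order_clone n (clone_order n C)\<close>, the coordinates \<open>j\<close> with \<open>j \<le>\<^sub>C i\<close> are the
  intersection of all \<open>S\<close> containing \<open>i\<close> with invariant kernel, each of which determines coordinate
  \<open>i\<close> of every member. For the converse, \<open>f\<close> is recombined from all \<open>m\<close>-ary members of \<open>C\<close>, of which
  there are finitely many.\<close>

lemma rich_clone_eq_order_clone:
  assumes C: "rich_clone n C"
  shows "C = order_clone n (clone_order n C)"
proof (intro equalityI subrelI)
  note cl = rich_clone_clone[OF C]
  fix m f assume f: "(m, f) \<in> C"
  have "determined n m f {j. (j, i) \<in> clone_order n C} i" if i: "i \<in> {1..n}" for i
  proof -
    let ?F = "{S. S \<subseteq> {1..n} \<and> agree n S \<in> Inv (cube n) C 2 \<and> i \<in> S}"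
    note iff = agree_Inv_iff[of C n, OF clone_op[OF cl]]
    have "determined n m f (\<Inter>?F) i"
    proof (rule determined_Inter)
      show "?F \<noteq> {}" using i determined_all iff[of "{1..n}"] by blast
    qed (use f iff in auto)
    moreover have "{1..n} \<in> ?F" using i determined_all iff[of "{1..n}"] by blast
    then have sub: "\<Inter>?F \<subseteq> {1..n}" by (rule Inter_lower)
    have "\<Inter>?F = {j. (j, i) \<in> clone_order n C}"
    proof (intro set_eqI iffI CollectI)
      fix j assume j: "j \<in> \<Inter>?F"
      then have "j \<in> {1..n}" using sub by (rule subsetD[rotated])
      moreover have "\<forall>S\<subseteq>{1..n}. agree n S \<in> Inv (cube n) C 2 \<longrightarrow> i \<in> S \<longrightarrow> j \<in> S"
        using j by simp
      ultimately show "(j, i) \<in> clone_order n C"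
        using i clone_order_iff[OF C, of j i] by simp
    next
      fix j assume "j \<in> {j. (j, i) \<in> clone_order n C}"
      then have "\<forall>S\<subseteq>{1..n}. agree n S \<in> Inv (cube n) C 2 \<longrightarrow> i \<in> S \<longrightarrow> j \<in> S"
        using clone_order_iff[OF C, of j i] by simp
      then show "j \<in> \<Inter>?F" by simp
    qed
    ultimately show ?thesis by simp
  qed
  then show "(m, f) \<in> order_clone n (clone_order n C)"
    by (intro order_cloneI clone_op[OF cl f])
next
  note cl = rich_clone_clone[OF C]
  fix m f assume "(m, f) \<in> order_clone n (clone_order n C)"
  then have fop: "f \<in> operations m (cube n)"
    and det: "\<And>i. i \<in> {1..n} \<Longrightarrow> determined n m f {j. (j, i) \<in> clone_order n C} i"
    by (rule order_clone_op, rule order_clone_determined)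
  \<comment> \<open>The set \<open>S\<close> of coordinates at which no \<open>m\<close>-ary member of \<open>C\<close> separates \<open>x\<close> from \<open>y\<close> has an
    invariant kernel; containing \<open>i\<close>, it contains every \<open>j \<le>\<^sub>C i\<close>, and the projections are
    among the members that do not separate there.\<close>
  have sep: "f x i = f y i"
    if i: "i \<in> {1..n}" and x: "x \<in> tuples m (cube n)" and y: "y \<in> tuples m (cube n)"
      and eq: "\<And>g. (m, g) \<in> C \<Longrightarrow> g x i = g y i" for i x y
  proof (rule determinedD[OF det[OF i] x y])
    fix k j assume k: "k \<in> {1..m}" and "j \<in> {j. (j, i) \<in> clone_order n C}"
    then have ji: "\<forall>S\<subseteq>{1..n}. agree n S \<in> Inv (cube n) C 2 \<longrightarrow> i \<in> S \<longrightarrow> j \<in> S"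
      using clone_order_iff[OF C, of j i] by simp
    define S where "S = {j \<in> {1..n}. \<forall>g. (m, g) \<in> C \<longrightarrow> g x j = g y j}"
    have "agree n S \<in> Inv (cube n) C 2" unfolding S_def by (rule agree_of_pair_Inv[OF C x y])
    moreover have "S \<subseteq> {1..n}" by (auto simp only: S_def)
    moreover have "i \<in> S" unfolding S_def using i eq by (intro CollectI conjI allI impI)
    ultimately have "j \<in> S" using ji by simp
    then have "\<forall>g. (m, g) \<in> C \<longrightarrow> g x j = g y j" unfolding S_def by (elim CollectE conjE)
    from mp[OF spec[OF this] clone_projection[OF cl k]]
    have "projection (cube n) m k x j = projection (cube n) m k y j" .
    then show "x k j = y k j" using x y by (simp add: projection_def)
  qed
  have "finite {g. (m, g) \<in> C}"
    by (rule finite_subset[OF _ finite_operations[of "cube n" m]])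
      (use clone_op[OF cl] finite_tuples[of "UNIV :: bool set" n] in auto)
  from ex_bij_betw_nat_finite_1[OF this]
  obtain h where "bij_betw h {1..card {g. (m, g) \<in> C}} {g. (m, g) \<in> C}" by (elim exE)
  moreover define N where "N = card {g. (m, g) \<in> C}"
  ultimately have h: "h ` {1..N} = {g. (m, g) \<in> C}" by (simp add: bij_betw_def)
  \<comment> \<open>\<open>v\<close> lists the values at \<open>i\<close> of all members of \<open>C\<close> at some input; by \<open>sep\<close>, any input with these
    values may stand in for the actual one.\<close>
  let ?F = "\<lambda>i v. f (SOME x. x \<in> tuples m (cube n) \<and> (\<forall>k\<in>{1..N}. h k x i = v k)) i"
  let ?f = "\<lambda>t\<in>tuples m (cube n). \<lambda>i\<in>{1..n}. ?F i (\<lambda>k\<in>{1..N}. h k t i)"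
  have fC: "(m, ?f) \<in> C" by (rule rich_clone_recombine[OF C]) (use h in auto)
  have "f = ?f"
  proof (rule operation_eqI[OF fop clone_op[OF cl fC]])
    fix t assume t: "t \<in> tuples m (cube n)"
    have "f t i = ?F i (\<lambda>k\<in>{1..N}. h k t i)" if i: "i \<in> {1..n}" for i
    proof -
      let ?P = "\<lambda>x. x \<in> tuples m (cube n) \<and> (\<forall>k\<in>{1..N}. h k x i = (\<lambda>k\<in>{1..N}. h k t i) k)"
      have P: "?P (SOME x. ?P x)" by (rule someI[of ?P t]) (use t in auto)
      show ?thesis
      proof (rule sep[OF i t])
        fix g assume "(m, g) \<in> C"
        then obtain k where "k \<in> {1..N}" "g = h k" using h by blast
        then show "g t i = g (SOME x. ?P x) i" using P by simp
      qed (use P in simp)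
    qed
    then show "f t = ?f t"
      by (intro tuples_eqI[OF operation_app[OF fop t] operation_app[OF clone_op[OF cl fC] t]])
        (use t in simp)
  qed
  then show "(m, f) \<in> C" using fC by simp
qed

lemma copy_in_order_clone:
  assumes "(j, i) \<in> R" and i: "i \<in> {1..n}"
  shows "(1, \<lambda>t\<in>tuples 1 (cube n). point n i (t 1 j)) \<in> order_clone n R"
proof -
  have "(\<lambda>t\<in>tuples 1 (cube n). point n i (t 1 j)) \<in> operations 1 (cube n)"
    using point_in_cube by (auto simp: operations_def)
  then show ?thesis using assms by (auto simp: order_clone_def determined_def point_def)
qed

text \<open>Membership in \<open>order_clone n (clone_order n C)\<close> is how \<open>C\<close> is seen to contain the copying
  operation.\<close>

lemma Inv_copy:
  assumes C: "rich_clone n C" and ji: "(j, i) \<in> clone_order n C"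
    and r: "r \<in> Inv (cube n) C m" and x: "x \<in> r"
  shows "(\<lambda>a\<in>{1..m}. point n i (x a j)) \<in> r"
proof -
  have i: "i \<in> {1..n}" using ji by (simp add: clone_order_def)
  let ?e = "\<lambda>t\<in>tuples 1 (cube n). point n i (t 1 j)"
  have "(1, ?e) \<in> C"
    using copy_in_order_clone[OF ji i] rich_clone_eq_order_clone[OF C] by simp
  then have "(\<lambda>a\<in>{1..m}. ?e (\<lambda>k\<in>{1..1}. x a)) \<in> r"
    using x by (intro Inv_apply[OF r, where x = "\<lambda>_. x"])
  also have "(\<lambda>a\<in>{1..m}. ?e (\<lambda>k\<in>{1..1}. x a)) = (\<lambda>a\<in>{1..m}. point n i (x a j))"
  proof (rule restrict_ext)
    fix a assume "a \<in> {1..m}"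
    then have "(\<lambda>k\<in>{1..1::nat}. x a) \<in> tuples 1 (cube n)"
      using x Inv_subset[OF r] by (intro tuples_restrict) (auto intro: tuple_app)
    then show "?e (\<lambda>k\<in>{1..1}. x a) = point n i (x a j)" by simp
  qed
  finally show ?thesis .
qed

lemma axis_copy_back:
  assumes x: "x \<in> tuples m (axis n i)" and i: "i \<in> {1..n}" and j: "j \<in> {1..n}"
  shows "(\<lambda>a\<in>{1..m}. point n i ((\<lambda>a\<in>{1..m}. point n j (x a i)) a j)) = x" (is "?y = x")
proof (rule tuples_eqI[OF _ x])
  show "?y \<in> tuples m (cube n)" by (intro tuples_restrict point_in_cube)
  fix a assume a: "a \<in> {1..m}"
  have "x a \<in> axis n i" by (rule tuple_app[OF x a])
  then show "?y a = x a"
    using a j i by (intro tuples_eqI[of _ n UNIV _ UNIV]) (auto simp: axis_eq point_def intro!: tuples_restrict)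
qed

section \<open>Irredundance makes the order antisymmetric\<close>

lemma axis_inj: "inj_on (axis n) {1..n}"
proof (rule inj_onI)
  fix i j assume i: "i \<in> {1..n}" and eq: "axis n i = axis n j"
  have "point n i True \<in> axis n j" using point_in_axis[of n i True] unfolding eq .
  then have "i \<noteq> j \<longrightarrow> \<not> point n i True i" using i unfolding axis_eq by blast
  then show "i = j" using i by (auto simp: point_def)
qed

text \<open>A tuple on axis \<open>i\<close> can be copied to axis \<open>j\<close>, where \<open>r\<close> and \<open>s\<close> agree, and then copied back.\<close>

lemma equivalent_axis_redundant:
  assumes C: "rich_clone n C" and o: "(i, j) \<in> clone_order n C" "(j, i) \<in> clone_order n C"
    and ne: "i \<noteq> j"
  shows "cover (cube n) C (axis n ` ({1..n} - {i}))"
  unfolding cover_def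
proof (intro conjI allI ballI impI)
  fix U assume "U \<in> axis n ` ({1..n} - {i})"
  then show "neighbourhood (cube n) C U" using axis_neighbourhood[OF C] by auto
next
  have ij: "i \<in> {1..n}" "j \<in> {1..n}" using o by (auto simp: clone_order_def)
  have sub: "r \<inter> tuples m (axis n i) \<subseteq> s"
    if r: "r \<in> Inv (cube n) C m" and s: "s \<in> Inv (cube n) C m"
      and eq: "r \<inter> tuples m (axis n j) = s \<inter> tuples m (axis n j)" for m r s
  proof
    fix x assume x: "x \<in> r \<inter> tuples m (axis n i)"
    let ?x = "\<lambda>a\<in>{1..m}. point n j (x a i)"
    have "?x \<in> r" by (rule Inv_copy[OF C o(1) r]) (use x in simp)
    moreover have "?x \<in> tuples m (axis n j)"
      by (intro tuples_restrict point_in_axis)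
    ultimately have "?x \<in> s" using eq by blast
    from Inv_copy[OF C o(2) s this] show "x \<in> s"
      using axis_copy_back[OF _ ij] x by simp
  qed
  fix m r s assume r: "r \<in> Inv (cube n) C m" and s: "s \<in> Inv (cube n) C m"
    and eq: "\<forall>U\<in>axis n ` ({1..n} - {i}). r \<inter> tuples m U = s \<inter> tuples m U"
  from eq have j: "r \<inter> tuples m (axis n j) = s \<inter> tuples m (axis n j)" using ij ne by simp
  have i: "r \<inter> tuples m (axis n i) = s \<inter> tuples m (axis n i)"
    using sub[OF r s j] sub[OF s r j[symmetric]] by blast
  show "r = s"
  proof (rule coverD[OF axes_cover[OF C] r s])
    fix U assume "U \<in> axis n ` {1..n}"
    then obtain l where "l \<in> {1..n}" "U = axis n l" by blast
    then show "r \<inter> tuples m U = s \<inter> tuples m U" using eq i by (cases "l = i") auto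
  qed
qed

lemma clone_order_partial_order:
  assumes C: "rich_clone n C" and irr: "irredundant (cube n) C (axis n ` {1..n})"
  shows "partial_order_on {1..n} (clone_order n C)"
proof -
  have "i = j" if o: "(i, j) \<in> clone_order n C" "(j, i) \<in> clone_order n C" for i j
  proof (rule ccontr)
    assume "i \<noteq> j"
    then have "cover (cube n) C (axis n ` ({1..n} - {i}))"
      by (rule equivalent_axis_redundant[OF C o])
    moreover have "axis n ` ({1..n} - {i}) \<subset> axis n ` {1..n}"
    proof -
      have i: "i \<in> {1..n}" using o by (simp add: clone_order_def)
      have "axis n i \<notin> axis n ` ({1..n} - {i})"
      proof
        assume "axis n i \<in> axis n ` ({1..n} - {i})"
        then obtain l where l: "l \<in> {1..n}" "l \<noteq> i" "axis n i = axis n l" by blast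
        then show False using inj_onD[OF axis_inj l(3) i l(1)] by simp
      qed
      then show ?thesis using i by blast
    qed
    ultimately show False
      using mp[OF spec[OF irr[unfolded irredundant_def], of "axis n ` ({1..n} - {i})"]] by simp
  qed
  moreover have "clone_order n C \<subseteq> {1..n} \<times> {1..n}" by (auto simp: clone_order_def)
  moreover have "refl_on {1..n} (clone_order n C)" by (simp add: refl_on_def clone_order_def)
  moreover have "trans (clone_order n C)"
  proof (rule transI)
    fix i j k assume "(i, j) \<in> clone_order n C" "(j, k) \<in> clone_order n C"
    then show "(i, k) \<in> clone_order n C"
      unfolding clone_order_iff[OF C] by (elim conjE) (intro conjI allI impI; simp)
  qed
  ultimately show ?thesis
    by (auto simp: partial_order_on_def preorder_on_def antisym_def)
qed

section \<open>Every partial order occurs\<close>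

text \<open>Reflexivity is what the projections and the componentwise operations need, and transitivity what
  compositions need.\<close>

lemma rich_order_clone:
  assumes refl: "\<And>i. i \<in> {1..n} \<Longrightarrow> (i, i) \<in> R" and tr: "trans R" and R: "R \<subseteq> {1..n} \<times> {1..n}"
  shows "rich_clone n (order_clone n R)"
  unfolding rich_clone_def clone_def
proof (intro conjI allI impI ballI; (elim conjE)?)
  fix c assume "c \<in> order_clone n R"
  then show "case c of (m, f) \<Rightarrow> f \<in> operations m (cube n)" by (auto simp: order_clone_def)
next
  fix m k :: nat assume k: "k \<in> {1..m}"
  have "projection (cube n) m k \<in> operations m (cube n)"
    using k tuple_app by (auto simp: projection_def operations_def)
  then show "(m, projection (cube n) m k) \<in> order_clone n R"
    using k refl by (auto simp: order_clone_def projection_def determined_def)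
next
  fix N m f g assume f: "(N, f) \<in> order_clone n R" and g: "\<forall>i\<in>{1..N}. (m, g i) \<in> order_clone n R"
  let ?h = "compose_op (cube n) N m f g"
  have t: "(\<lambda>k\<in>{1..N}. g k x) \<in> tuples N (cube n)" if "x \<in> tuples m (cube n)" for x
    by (intro tuples_restrict operation_app[OF order_clone_op[OF bspec[OF g]] that])
  have op: "?h \<in> operations m (cube n)"
    using operation_app[OF order_clone_op[OF f] t] by (simp add: compose_op_def operations_def)
  have "determined n m ?h {j. (j, i) \<in> R} i" if i: "i \<in> {1..n}" for i
    unfolding determined_def
  proof (intro ballI impI)
    fix x y assume x: "x \<in> tuples m (cube n)" and y: "y \<in> tuples m (cube n)"
      and eq: "\<forall>k\<in>{1..m}. \<forall>j\<in>{j. (j, i) \<in> R}. x k j = y k j"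
    have "f (\<lambda>k\<in>{1..N}. g k x) i = f (\<lambda>k\<in>{1..N}. g k y) i"
    proof (rule determinedD[of n N f "{j. (j, i) \<in> R}"])
      show "determined n N f {j. (j, i) \<in> R} i" by (rule order_clone_determined[OF f i])
      fix k j assume k: "k \<in> {1..N}" and j: "j \<in> {j. (j, i) \<in> R}"
      have "j \<in> {1..n}" using j R by auto
      from order_clone_determined[OF bspec[OF g k] this] have "g k x j = g k y j"
      proof (rule determinedD[OF _ x y])
        fix a l assume "a \<in> {1..m}" "l \<in> {l. (l, j) \<in> R}"
        moreover from this have "(l, i) \<in> R" using transD[OF tr, of l j i] j by simp
        ultimately show "x a l = y a l" using eq by simp
      qed
      then show "(\<lambda>k\<in>{1..N}. g k x) k j = (\<lambda>k\<in>{1..N}. g k y) k j" using k by simp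
    qed (use t x y in auto)
    then show "?h x i = ?h y i" using x y by (simp add: compose_op_def)
  qed
  then show "(m, ?h) \<in> order_clone n R" using op by (intro order_cloneI)
next
  fix m f assume f: "\<forall>i\<in>{1..n}. f i \<in> operations m (UNIV :: bool set)"
  let ?h = "componentwise n m f"
  have op: "?h \<in> operations m (cube n)"
    by (auto simp: componentwise_def operations_def intro!: tuples_restrict)
  have "determined n m ?h {j. (j, i) \<in> R} i" if i: "i \<in> {1..n}" for i
    unfolding determined_def
  proof (intro ballI impI)
    fix x y assume x: "x \<in> tuples m (cube n)" and y: "y \<in> tuples m (cube n)"
      and eq: "\<forall>k\<in>{1..m}. \<forall>j\<in>{j. (j, i) \<in> R}. x k j = y k j"
    have "(\<lambda>k\<in>{1..m}. x k i) = (\<lambda>k\<in>{1..m}. y k i)"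
      by (rule restrict_ext) (use eq refl[OF i] in auto)
    then show "?h x i = ?h y i" using x y i by (simp add: componentwise_def)
  qed
  then show "(m, ?h) \<in> order_clone n R" using op by (intro order_cloneI)
qed

lemma agree_downset_Inv:
  assumes S: "S \<subseteq> {1..n}" and down: "\<And>i j. i \<in> S \<Longrightarrow> (j, i) \<in> R \<Longrightarrow> j \<in> S"
  shows "agree n S \<in> Inv (cube n) (order_clone n R) 2"
proof -
  have ops: "f \<in> operations m (cube n)" if "(m, f) \<in> order_clone n R" for m f
    using that by (auto simp: order_clone_def)
  have "determined n m f S i" if "(m, f) \<in> order_clone n R" "i \<in> S" for m f i
  proof (rule determined_mono)
    show "determined n m f {j. (j, i) \<in> R} i"
      using order_clone_determined[OF that(1)] that(2) S by blast
    show "{j. (j, i) \<in> R} \<subseteq> S" using down that(2) by blast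
  qed
  then show ?thesis using agree_Inv_iff[of _ n, OF ops] by blast
qed

text \<open>Principal downsets give one inclusion. For the other, the operation that copies \<open>i\<close> to \<open>i'\<close>
  violates every kernel whose \<open>S\<close> contains \<open>i'\<close> without \<open>i\<close>.\<close>

lemma clone_order_order_clone:
  assumes refl: "\<And>i. i \<in> {1..n} \<Longrightarrow> (i, i) \<in> R" and tr: "trans R" and R: "R \<subseteq> {1..n} \<times> {1..n}"
  shows "clone_order n (order_clone n R) = R"
proof -
  note rich = rich_order_clone[OF refl tr R]
  have "(i, i') \<in> clone_order n (order_clone n R) \<longleftrightarrow> (i, i') \<in> R" for i i'
  proof
    assume o: "(i, i') \<in> clone_order n (order_clone n R)"
    then have i': "i' \<in> {1..n}" by (simp add: clone_order_def)
    have "agree n {j. (j, i') \<in> R} \<in> Inv (cube n) (order_clone n R) 2"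
      by (rule agree_downset_Inv) (use R tr in \<open>auto dest: transD\<close>)
    moreover have "{j. (j, i') \<in> R} \<subseteq> {1..n}" using R by auto
    ultimately have "i \<in> {j. (j, i') \<in> R}"
      by (intro clone_order_mem[OF rich o]) (simp_all add: refl[OF i'])
    then show "(i, i') \<in> R" by simp
  next
    assume o: "(i, i') \<in> R"
    have "i \<in> S" if S: "S \<subseteq> {1..n}" "agree n S \<in> Inv (cube n) (order_clone n R) 2" "i' \<in> S" for S
    proof (rule ccontr)
      assume i: "i \<notin> S"
      let ?f = "\<lambda>t\<in>tuples 1 (cube n). point n i' (t 1 i)"
      let ?x = "\<lambda>b. \<lambda>k\<in>{1..1::nat}. point n i b"
      have x: "?x b \<in> tuples 1 (cube n)" for b by (intro tuples_restrict point_in_cube)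
      have "(1, ?f) \<in> order_clone n R" using copy_in_order_clone o R by blast
      then have "determined n 1 ?f S i'"
        using S agree_Inv_iff[of "order_clone n R" n S] by (auto simp: order_clone_def)
      then have "?f (?x True) i' = ?f (?x False) i'"
        by (rule determinedD[OF _ x x]) (use i S(1) in \<open>auto simp: point_def\<close>)
      then have "point n i' (point n i True i) i' = point n i' (point n i False i) i'"
        using x by simp
      moreover have "i \<in> {1..n}" "i' \<in> {1..n}" using o R by auto
      ultimately show False by (simp add: point_def)
    qed
    then show "(i, i') \<in> clone_order n (order_clone n R)"
      using o R clone_order_iff[OF rich, of i i'] by auto
  qed
  then show ?thesis by (intro equalityI subrelI) simp_all
qed

text \<open>If axis \<open>i\<close> is missing, then coordinate \<open>i\<close> is constant on every member of the cover, because an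
  axis has just two points. Such members cannot tell apart the kernels for the downset of \<open>i\<close>
  with and without \<open>i\<close>.\<close>

lemma refining_cover_contains_axes:
  assumes po: "partial_order_on {1..n} R"
    and cov: "cover (cube n) (order_clone n R) \<V>"
    and ref: "refines \<V> (axis n ` {1..n})" and i: "i \<in> {1..n}"
  shows "axis n i \<in> \<V>"
proof (rule ccontr)
  assume out: "axis n i \<notin> \<V>"
  have R: "R \<subseteq> {1..n} \<times> {1..n}" and tr: "trans R" and anti: "antisym R" and refl: "(i, i) \<in> R"
    using po i by (auto simp: partial_order_on_def preorder_on_def refl_on_def)
  have const: "x i = y i" if V: "V \<in> \<V>" and x: "x \<in> V" and y: "y \<in> V" for V x y
  proof -
    obtain j where j: "j \<in> {1..n}" "V \<subseteq> axis n j" using ref V by (auto simp: refines_def)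
    show ?thesis
    proof (cases "j = i")
      case False
      have "x \<in> axis n j" "y \<in> axis n j" using x y j by auto
      then show ?thesis using False i by (auto simp: axis_eq)
    next
      case True
      show ?thesis
      proof (rule ccontr)
        assume ne: "x i \<noteq> y i"
        have "z \<in> V" if z: "z \<in> axis n i" for z
        proof -
          have E: "z = w" if w: "w \<in> V" "z i = w i" for w
          proof -
            have "w \<in> axis n i" using w(1) j True by blast
            then show ?thesis using axis_point[OF z] axis_point[of w n i] w(2) by simp
          qed
          show ?thesis using E[OF x] E[OF y] x y ne by auto
        qed
        then show False using out V j True by (metis subsetI subset_antisym)
      qed
    qed
  qed
  let ?T = "{j. (j, i) \<in> R}" let ?S = "?T - {i}"
  have T: "agree n ?T \<in> Inv (cube n) (order_clone n R) 2"
    by (rule agree_downset_Inv) (use R tr in \<open>auto dest: transD\<close>)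
  have S: "agree n ?S \<in> Inv (cube n) (order_clone n R) 2"
    by (rule agree_downset_Inv) (use R tr anti in \<open>auto dest: transD antisymD\<close>)
  have "agree n ?T \<inter> tuples 2 V = agree n ?S \<inter> tuples 2 V" if V: "V \<in> \<V>" for V
  proof -
    have "p 1 i = p 2 i" if "p \<in> tuples 2 V" for p
      using const[OF V] tuple_app[OF that] by simp
    then show ?thesis unfolding agree_def by auto
  qed
  then have eq: "agree n ?T = agree n ?S" by (rule coverD[OF cov T S])
  \<comment> \<open>The pair of the two points of axis \<open>i\<close>.\<close>
  let ?p = "\<lambda>a\<in>{1..2::nat}. point n i (a = 1)"
  have "?p \<in> agree n ?S"
    using R by (auto simp: agree_def point_def intro!: tuples_restrict)
  then have "?p \<in> agree n ?T" using eq by simp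
  then show False using refl i by (auto simp: agree_def point_def)
qed

lemma order_clone_in_E:
  assumes po: "partial_order_on {1..n} R"
  shows "order_clone n R \<in> E n"
proof -
  have R: "R \<subseteq> {1..n} \<times> {1..n}" and tr: "trans R" and refl: "\<And>i. i \<in> {1..n} \<Longrightarrow> (i, i) \<in> R"
    using po by (auto simp: partial_order_on_def preorder_on_def refl_on_def)
  note rich = rich_order_clone[OF refl tr R]
  note axes = refining_cover_contains_axes[OF po]
  have "irredundant (cube n) (order_clone n R) (axis n ` {1..n})"
    unfolding irredundant_def
  proof (intro allI impI notI)
    fix \<V> assume V: "\<V> \<subset> axis n ` {1..n}" and "cover (cube n) (order_clone n R) \<V>"
    moreover have "refines \<V> (axis n ` {1..n})" using V unfolding refines_def by blast
    ultimately have "axis n ` {1..n} \<subseteq> \<V>" using axes[of \<V>] by auto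
    then show False using V by blast
  qed
  moreover have "non_refinable (cube n) (order_clone n R) (axis n ` {1..n})"
    unfolding non_refinable_def proper_refinement_def
  proof (intro notI, elim exE conjE)
    fix \<V> assume "cover (cube n) (order_clone n R) \<V>" "refines \<V> (axis n ` {1..n})"
      and not: "\<not> refines (axis n ` {1..n}) \<V>"
    then have "axis n ` {1..n} \<subseteq> \<V>" using axes[of \<V>] by auto
    then show False using not by (auto simp: refines_def)
  qed
  ultimately show ?thesis
    using axes_cover[OF rich] rich unfolding E_def rich_clone_def
    by (intro CollectI conjI) simp_all
qed

theorem theorem3p2:
  fixes n :: nat
  shows "bij_betw (clone_order n) (E n) (partial_orders n)"
proof (rule bij_betw_byWitness[where f' = "order_clone n"])
  have rich: "rich_clone n C" if "C \<in> E n" for C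
    using that by (auto simp: E_def rich_clone_def)
  show "\<forall>C\<in>E n. order_clone n (clone_order n C) = C"
    using rich rich_clone_eq_order_clone by metis
  show "\<forall>R\<in>partial_orders n. clone_order n (order_clone n R) = R"
  proof
    fix R assume "R \<in> partial_orders n"
    then show "clone_order n (order_clone n R) = R"
      by (intro clone_order_order_clone)
        (auto simp: partial_orders_def partial_order_on_def preorder_on_def refl_on_def)
  qed
  show "clone_order n ` E n \<subseteq> partial_orders n"
    using clone_order_partial_order[OF rich] by (auto simp: partial_orders_def E_def)
  show "order_clone n ` partial_orders n \<subseteq> E n"
    using order_clone_in_E by (auto simp: partial_orders_def)
qed

end
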